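(* If $G$ is a nonempty graph with a unique minimum Roman dominating function (that is, exactly one Roman dominating function on $G$ has weight $\gamma_{\rm R}(G)$), then $b_{\rm R}(G)=1$.
   Context: Graphs are finite, undirected, without loops or multiple edges; a graph is nonempty if it has at least one edge. A Roman dominating function on $G=(V,E)$ is a function $f:V\to\{0,1,2\}$ such that every vertex $x$ with $f(x)=0$ is adjacent to at least one vertex $y$ with $f(y)=2$. Its weight is $\sum_{u\in V}f(u)$. The Roman domination number $\gamma_{\rm R}(G)$ is the minimum weight of a Roman dominating function on $G$. The Roman bondage number of a nonempty graph $G$ is $b_{\rm R}(G)=\min\{|B|: B\subseteq E(G),\ \gamma_{\rm R}(G-B)>\gamma_{\rm R}(G)\}$, with $b_{\rm R}(G)=\infty$ if no such $B$ exists; here $G-B$ is obtained from $G$ by deleting the edges in $B$ (keeping all vertices). *)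

theory Defs
  imports Main "HOL-Library.FuncSet" "HOL-Library.Extended_Nat"
begin

(* Edges are unordered pairs, i.e. two-element sets of vertices; this excludes
   loops and multiple edges. *)
definition simple_graph :: "'a set \<Rightarrow> 'a set set \<Rightarrow> bool" where
  "simple_graph V E \<longleftrightarrow> finite V \<and> (\<forall>e\<in>E. e \<subseteq> V \<and> card e = 2)"

definition adjacent :: "'a set set \<Rightarrow> 'a \<Rightarrow> 'a \<Rightarrow> bool" where
  "adjacent E x y \<longleftrightarrow> {x, y} \<in> E"

(* The extensional function space makes f a function on V only, so that
   counting Roman dominating functions is meaningful. *)
definition roman_dominating :: "'a set \<Rightarrow> 'a set set \<Rightarrow> ('a \<Rightarrow> nat) \<Rightarrow> bool" where
  "roman_dominating V E f \<longleftrightarrow>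
     f \<in> V \<rightarrow>\<^sub>E {0, 1, 2} \<and>
     (\<forall>x\<in>V. f x = 0 \<longrightarrow> (\<exists>y\<in>V. adjacent E x y \<and> f y = 2))"

definition weight :: "'a set \<Rightarrow> ('a \<Rightarrow> nat) \<Rightarrow> nat" where
  "weight V f = (\<Sum>u\<in>V. f u)"

(* The infimum is over a nonempty set of naturals (the constant function 1 on V
   is Roman dominating), hence it is a minimum. *)
definition roman_domination_number :: "'a set \<Rightarrow> 'a set set \<Rightarrow> nat" where
  "roman_domination_number V E = Inf {weight V f | f. roman_dominating V E f}"

(* In enat the infimum of a nonempty set is attained, and the infimum of the
   empty set is infinity. *)
definition roman_bondage_number :: "'a set \<Rightarrow> 'a set set \<Rightarrow> enat" where
  "roman_bondage_number V E =
     Inf {enat (card B) | B. B \<subseteq> E \<and>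
            roman_domination_number V (E - B) > roman_domination_number V E}"

end

theory Submission
  imports Defs
begin

text \<open>
  Let \<open>f\<close> be the unique minimum Roman dominating function. A Roman dominating function of a
  spanning subgraph also dominates the whole graph, so the domination number can only grow when
  an edge \<open>e\<close> is deleted, and by uniqueness it stays the same only if \<open>f\<close> itself still dominates
  \<open>G - e\<close>. It therefore suffices to find one edge whose deletion destroys \<open>f\<close>.

  Suppose that \<open>f\<close> survives the deletion of every single edge. Then each vertex of value 0 has
  at least two neighbours of value 2, so any one vertex of value 2 can be lowered to 1, which
  contradicts minimality (\<open>robust_imp_lighter\<close>). Hence \<open>f\<close> takes no value 2, thus no value 0
  either, and is constantly 1. But then the ends of any edge can be given the values 0 and 2
  instead, which yields a second function of the same weight (\<open>all_ones_imp_rival\<close>).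
\<close>

lemma roman_dominating_mono:
  assumes "roman_dominating V E' f" and "E' \<subseteq> E"
  shows "roman_dominating V E f"
  using assms unfolding roman_dominating_def adjacent_def by blast

lemma roman_domination_number_le:
  assumes "roman_dominating V E f"
  shows "roman_domination_number V E \<le> weight V f"
  unfolding roman_domination_number_def by (rule cInf_lower) (use assms in auto)

lemma roman_domination_number_attained:
  obtains f where "roman_dominating V E f" and "weight V f = roman_domination_number V E"
proof -
  let ?W = "{weight V f | f. roman_dominating V E f}"
  have "roman_dominating V E (\<lambda>u\<in>V. 1)"
    unfolding roman_dominating_def by auto
  then have "?W \<noteq> {}" by blast
  then have "Inf ?W \<in> ?W" by (rule Inf_nat_def1)
  then show thesis
    using that unfolding roman_domination_number_def by auto
qed

lemma weight_fun_upd: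
  assumes "finite V" and "y \<in> V"
  shows "weight V (f(y := k)) + f y = weight V f + k"
proof -
  have "(\<Sum>u\<in>V - {y}. (f(y := k)) u) = (\<Sum>u\<in>V - {y}. f u)"
    by (rule sum.cong) auto
  then show ?thesis
    using assms unfolding weight_def by (simp add: sum.remove[of V y])
qed

text \<open>
  Deleting the edge from a vertex \<open>x\<close> of value 0 to \<open>y\<close> leaves \<open>x\<close> dominated, so \<open>x\<close> has a
  neighbour of value 2 other than \<open>y\<close>. Hence \<open>y\<close> does not need the value 2 for its neighbours.
\<close>

lemma robust_imp_lighter:
  assumes "finite V" and "E \<noteq> {}"
    and robust: "\<And>e. e \<in> E \<Longrightarrow> roman_dominating V (E - {e}) f"
    and y: "y \<in> V" "f y = 2"
  shows "roman_dominating V E (f(y := 1))" and "weight V (f(y := 1)) < weight V f"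
proof -
  \<comment> \<open>Extended to non-edges, so that below \<open>y\<close> need not be a neighbour of \<open>x\<close>.\<close>
  have surviving: "roman_dominating V (E - {e}) f" for e
  proof (cases "e \<in> E")
    case False
    from \<open>E \<noteq> {}\<close> obtain e' where "e' \<in> E" by blast
    then have "roman_dominating V E f"
      using robust roman_dominating_mono by blast
    with False show ?thesis by simp
  qed (rule robust)
  have "\<exists>z\<in>V. adjacent E x z \<and> (f(y := 1)) z = 2"
    if "x \<in> V" "(f(y := 1)) x = 0" for x
  proof -
    have "f x = 0" using that by (auto split: if_splits)
    then obtain z where "z \<in> V" "{x, z} \<in> E - {{x, y}}" "f z = 2"
      using surviving[of "{x, y}"] \<open>x \<in> V\<close>
      unfolding roman_dominating_def adjacent_def by blast
    then show ?thesis unfolding adjacent_def by (intro bexI[of _ z]) auto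
  qed
  moreover have "f(y := 1) \<in> V \<rightarrow>\<^sub>E {0, 1, 2}"
    using surviving y unfolding roman_dominating_def by (auto simp: PiE_iff extensional_def)
  ultimately show "roman_dominating V E (f(y := 1))"
    unfolding roman_dominating_def by blast
  show "weight V (f(y := 1)) < weight V f"
    using weight_fun_upd[of V y f 1] \<open>finite V\<close> y by simp
qed

text \<open>
  In a function that is constantly 1 no vertex relies on another, so the two units of weight on
  the ends of an edge can be moved to one end, which then dominates the other.
\<close>

lemma all_ones_imp_rival:
  assumes "finite V" and "f \<in> V \<rightarrow>\<^sub>E {1}"
    and edge: "x \<in> V" "y \<in> V" "x \<noteq> y" "{x, y} \<in> E"
  shows "roman_dominating V E (f(x := 0, y := 2))"
    and "weight V (f(x := 0, y := 2)) = weight V f"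
proof -
  have ones: "f u = 1" if "u \<in> V" for u
    using assms(2) that by auto
  show "roman_dominating V E (f(x := 0, y := 2))"
    using assms(2) edge ones unfolding roman_dominating_def adjacent_def
    by (auto simp: PiE_iff extensional_def)
  show "weight V (f(x := 0, y := 2)) = weight V f"
    using weight_fun_upd[of V x f 0] weight_fun_upd[of V y "f(x := 0)" 2] \<open>finite V\<close> edge ones
    by simp
qed

lemma unique_minimum_imp_critical_edge:
  assumes graph: "simple_graph V E" and "E \<noteq> {}"
    and f: "roman_dominating V E f" "weight V f = roman_domination_number V E"
    and unique: "\<And>g. roman_dominating V E g \<Longrightarrow> weight V g = roman_domination_number V E \<Longrightarrow> g = f"
  shows "\<exists>e\<in>E. \<not> roman_dominating V (E - {e}) f"
proof (rule ccontr)
  assume "\<not> ?thesis"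
  then have robust: "\<And>e. e \<in> E \<Longrightarrow> roman_dominating V (E - {e}) f" by blast
  have "finite V" using graph unfolding simple_graph_def by blast
  have no_two: "f y \<noteq> 2" if "y \<in> V" for y
  proof
    assume "f y = 2"
    from robust_imp_lighter[OF \<open>finite V\<close> \<open>E \<noteq> {}\<close> robust that this]
    show False using roman_domination_number_le f(2) by fastforce
  qed
  have "f u = 1" if "u \<in> V" for u
  proof -
    have "f u \<noteq> 0"
      using f(1) no_two that unfolding roman_dominating_def by blast
    moreover have "f u \<in> {0, 1, 2}"
      using f(1) that unfolding roman_dominating_def by (auto simp: PiE_iff)
    ultimately show ?thesis using no_two[OF that] by auto
  qed
  moreover have "f \<in> extensional V"
    using f(1) unfolding roman_dominating_def by (auto simp: PiE_iff)
  ultimately have ones: "f \<in> V \<rightarrow>\<^sub>E {1}"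
    unfolding PiE_iff by blast
  from \<open>E \<noteq> {}\<close> obtain e where "e \<in> E" by blast
  with graph have "e \<subseteq> V" "card e = 2" unfolding simple_graph_def by auto
  with \<open>e \<in> E\<close> obtain x y where edge: "x \<in> V" "y \<in> V" "x \<noteq> y" "{x, y} \<in> E"
    by (auto simp: card_2_iff)
  note rival = all_ones_imp_rival[OF \<open>finite V\<close> ones edge]
  have "f(x := 0, y := 2) = f"
    by (rule unique[OF rival(1) trans[OF rival(2) f(2)]])
  then have "f y = 2" by (metis fun_upd_same)
  with no_two edge show False by blast
qed

lemma critical_edge_imp_domination_number_less:
  assumes unique: "\<And>g. roman_dominating V E g \<Longrightarrow> weight V g = roman_domination_number V E \<Longrightarrow> g = f"
    and "\<not> roman_dominating V (E - {e}) f"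
  shows "roman_domination_number V E < roman_domination_number V (E - {e})"
proof -
  obtain g where g: "roman_dominating V (E - {e}) g"
      "weight V g = roman_domination_number V (E - {e})"
    by (rule roman_domination_number_attained)
  have gE: "roman_dominating V E g"
    using g(1) by (rule roman_dominating_mono) blast
  have "weight V g \<noteq> roman_domination_number V E"
    using unique[OF gE] g(1) assms(2) by blast
  with roman_domination_number_le[OF gE] g(2) show ?thesis by simp
qed

theorem theorem5p7:
  fixes V :: "'a set" and E :: "'a set set"
  assumes "simple_graph V E"
    and "E \<noteq> {}"
    and "\<exists>!f. roman_dominating V E f \<and> weight V f = roman_domination_number V E"
  shows "roman_bondage_number V E = 1"
proof -
  let ?breaks = "\<lambda>B. B \<subseteq> E \<and> roman_domination_number V (E - B) > roman_domination_number V E"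
  obtain f where f: "roman_dominating V E f" "weight V f = roman_domination_number V E"
    and unique: "\<And>g. roman_dominating V E g \<Longrightarrow> weight V g = roman_domination_number V E \<Longrightarrow> g = f"
    using assms(3) by blast
  obtain e where "e \<in> E" "\<not> roman_dominating V (E - {e}) f"
    using unique_minimum_imp_critical_edge[OF assms(1,2) f unique] by blast
  then have breaks: "?breaks {e}"
    using critical_edge_imp_domination_number_less[OF unique] by blast
  have "E \<subseteq> Pow V" "finite V"
    using assms(1) unfolding simple_graph_def by auto
  then have "finite E" by (meson finite_Pow_iff finite_subset)
  have lower: "1 \<le> enat (card B)" if "?breaks B" for B
  proof -
    have "finite B" using that \<open>finite E\<close> finite_subset by blast
    moreover have "B \<noteq> {}" using that by auto
    ultimately have "1 \<le> card B" by (simp add: Suc_le_eq card_gt_0_iff)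
    then show ?thesis by (simp add: one_enat_def)
  qed
  show ?thesis
    unfolding roman_bondage_number_def
  proof (rule antisym)
    have "1 \<in> {enat (card B) | B. ?breaks B}"
      using breaks by (intro CollectI exI[of _ "{e}"]) (simp add: one_enat_def)
    then show "Inf {enat (card B) | B. ?breaks B} \<le> 1" by (rule Inf_lower)
    show "1 \<le> Inf {enat (card B) | B. ?breaks B}"
      by (rule Inf_greatest) (use lower in blast)
  qed
qed

end
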